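(* Consider the system $$X_0(t)=0,\qquad \dot{X}_n(t)=k_{n-1}X_{n-1}^2(t)-k_nX_n(t)X_{n+1}(t)\quad (t\ge 0,\ n\ge 1),\qquad k_n=2^n.$$ If $X$ is a positive finite energy solution, then $$\lim_{t\to\infty}|X(t)|_H^2=0.$$ Moreover, given $L>0$ and $\alpha>0$, there exists $\bar t>0$ depending only on $L$ and $\alpha$ such that for all positive finite energy solutions $X$ with $|X(0)|_H\le L$ we have $|X(\bar t)|_H^2\le\alpha$.
   Context: $H=l^2$ is the Hilbert space of square-summable real sequences $(x_n)_{n\ge1}$, with norm $|x|_H=(\sum_{n\ge1}x_n^2)^{1/2}$. A componentwise solution with initial condition $X^0\in\mathbb{R}^{\mathbb{N}}$ is a sequence $X=(X_n(\cdot))_{n\ge1}$ of continuously differentiable functions $X_n:[0,\infty)\to\mathbb{R}$ with $X_n(0)=X^0_n$ for all $n\ge1$, satisfying all equations of the system. It is positive if $X_n(t)\ge0$ for all $n\ge1$, $t\ge0$. It is a finite energy solution if $X(t)\in H$ for all $t\ge0$ (including $t=0$). *)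

theory Defs
  imports Complex_Main
begin

text \<open>
  Real sequences \<open>(x\<^sub>n)\<close>, \<open>n \<ge> 1\<close>, are functions on \<^typ>\<open>nat\<close> whose value at \<open>0\<close> is disregarded
  by the notions of \<open>H\<close> below.
\<close>

definition in_H :: "(nat \<Rightarrow> real) \<Rightarrow> bool" where
  "in_H x \<longleftrightarrow> summable (\<lambda>n. (x (Suc n))\<^sup>2)"

text \<open>Only meaningful for sequences in \<open>H\<close>, as the series is unspecified when it diverges.\<close>

definition norm_H :: "(nat \<Rightarrow> real) \<Rightarrow> real" where
  "norm_H x = sqrt (\<Sum>n. (x (Suc n))\<^sup>2)"

definition kcoeff :: "nat \<Rightarrow> real" where
  "kcoeff n = 2 ^ n"

text \<open>
  At the left endpoint \<open>0\<close> the derivative is one-sided; the predicate \<open>C1_differentiable_on\<close> of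
  \<open>HOL-Analysis\<close> would ask for a two-sided one.
\<close>

definition cont_differentiable_half_line :: "(real \<Rightarrow> real) \<Rightarrow> bool" where
  "cont_differentiable_half_line f \<longleftrightarrow>
     (\<exists>f'. (\<forall>t\<ge>0. (f has_real_derivative f' t) (at t within {0..})) \<and> continuous_on {0..} f')"

text \<open>\<open>X n t\<close> stands for \<open>X\<^sub>n(t)\<close>; values at negative times play no role.\<close>

definition componentwise_solution :: "(nat \<Rightarrow> real) \<Rightarrow> (nat \<Rightarrow> real \<Rightarrow> real) \<Rightarrow> bool" where
  "componentwise_solution x0 X \<longleftrightarrow>
     (\<forall>n\<ge>1. cont_differentiable_half_line (X n)) \<and>
     (\<forall>n\<ge>1. X n 0 = x0 n) \<and>
     (\<forall>t\<ge>0. X 0 t = 0) \<and>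
     (\<forall>n\<ge>1. \<forall>t\<ge>0. (X n has_real_derivative
        kcoeff (n - 1) * (X (n - 1) t)\<^sup>2 - kcoeff n * X n t * X (n + 1) t) (at t within {0..}))"

definition positive :: "(nat \<Rightarrow> real \<Rightarrow> real) \<Rightarrow> bool" where
  "positive X \<longleftrightarrow> (\<forall>n\<ge>1. \<forall>t\<ge>0. X n t \<ge> 0)"

definition finite_energy :: "(nat \<Rightarrow> real \<Rightarrow> real) \<Rightarrow> bool" where
  "finite_energy X \<longleftrightarrow> (\<forall>t\<ge>0. in_H (\<lambda>n. X n t))"

definition positive_finite_energy_solution :: "(nat \<Rightarrow> real \<Rightarrow> real) \<Rightarrow> bool" where
  "positive_finite_energy_solution X \<longleftrightarrow>
     (\<exists>x0. componentwise_solution x0 X) \<and> positive X \<and> finite_energy X"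

end

theory Submission
  imports Defs "HOL-Analysis.Analysis"
begin

text \<open>
  Energy is lost at a uniform rate because \<open>\<integral>\<^sub>0\<^sup>T X\<^sub>n\<^sup>3\<close> is at most \<open>13 L\<^sup>2 / k\<^sub>n\<close>, uniformly in \<open>T\<close>.
  Indeed the energy balance of the first \<open>n\<close> components bounds the flux
  \<open>2 k\<^sub>n \<integral>\<^sub>0\<^sup>T X\<^sub>n\<^sup>2 X\<^sub>n\<^sub>+\<^sub>1\<close> by \<open>L\<^sup>2\<close>, while the derivative of \<open>X\<^sub>n X\<^sub>n\<^sub>+\<^sub>1\<close> contains the term
  \<open>k\<^sub>n X\<^sub>n\<^sup>3\<close> and, up to a multiple of the flux and small multiples of \<open>k\<^sub>n\<^sub>+\<^sub>1 X\<^sub>n\<^sub>+\<^sub>1\<^sup>3\<close> and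
  \<open>k\<^sub>n\<^sub>+\<^sub>2 X\<^sub>n\<^sub>+\<^sub>2\<^sup>3\<close>, only terms of favourable sign. Hence \<open>y\<^sub>n = k\<^sub>n \<integral>\<^sub>0\<^sup>T X\<^sub>n\<^sup>3\<close> satisfies
  \<open>y\<^sub>n \<le> 11 L\<^sup>2 + (y\<^sub>n\<^sub>+\<^sub>1 + y\<^sub>n\<^sub>+\<^sub>2) / 16\<close>. The trivial bound \<open>y\<^sub>n \<le> 2\<^sup>n T L\<^sup>3\<close> grows slowly enough for
  iteration to give \<open>y\<^sub>n \<le> 13 L\<^sup>2\<close>. Interpolating, \<open>\<integral>\<^sub>0\<^sup>T |X|\<^sup>2\<close> is \<open>o(T)\<close> uniformly in \<open>X\<close>, and since the
  partial energies decrease, the energy at time \<open>T\<close> is at most the time average.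
\<close>

section \<open>Elementary inequalities and an iterated recursion\<close>

lemma square_le_cube_interpolation:
  fixes x r :: real
  assumes "0 \<le> x" "0 < r"
  shows "x\<^sup>2 \<le> r\<^sup>2 + x ^ 3 / r"
proof (cases "x \<le> r")
  case True
  then have "x\<^sup>2 \<le> r\<^sup>2" using assms by (simp add: power_mono)
  then show ?thesis using assms by (simp add: add_increasing2)
next
  case False
  then have "x\<^sup>2 * r \<le> x\<^sup>2 * x" by (intro mult_left_mono) auto
  then have "x\<^sup>2 \<le> x ^ 3 / r"
    using assms by (simp add: field_simps power3_eq_cube power2_eq_square)
  then show ?thesis by (simp add: add_increasing)
qed

text \<open>The left-hand side collects the unfavourable terms in the derivative of
  \<open>X n t * X (n + 1) t\<close>, divided by \<open>kcoeff n\<close>. A large weight on the flux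
  term keeps the cubes small: times \<open>kcoeff n\<close>, the factors \<open>1 / 8\<close> and
  \<open>1 / 4\<close> become \<open>kcoeff (n + 1) / 16\<close> and
  \<open>kcoeff (n + 2) / 16\<close>.\<close>

lemma cube_le_flux_and_cubes:
  fixes a b c :: real
  assumes "0 \<le> a" "0 \<le> b" "0 \<le> c"
  shows "a * b\<^sup>2 + 2 * a * b * c \<le> 20 * a\<^sup>2 * b + (1 / 8) * b ^ 3 + (1 / 4) * c ^ 3"
proof -
  have 1: "b * (a * b) \<le> b * (10 * a\<^sup>2 + b\<^sup>2 / 40)"
  proof (rule mult_left_mono)
    have "0 \<le> (20 * a - b)\<^sup>2" by simp
    then show "a * b \<le> 10 * a\<^sup>2 + b\<^sup>2 / 40" by (simp add: power2_eq_square algebra_simps)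
  qed fact
  have 2: "b * (2 * a * c) \<le> b * (10 * a\<^sup>2 + c\<^sup>2 / 10)"
  proof (rule mult_left_mono)
    have "0 \<le> (10 * a - c)\<^sup>2" by simp
    then show "2 * a * c \<le> 10 * a\<^sup>2 + c\<^sup>2 / 10" by (simp add: power2_eq_square algebra_simps)
  qed fact
  have 3: "b * c\<^sup>2 \<le> b ^ 3 + c ^ 3"
  proof (cases "b \<le> c")
    case True
    then have "b * c\<^sup>2 \<le> c * c\<^sup>2" by (intro mult_right_mono) auto
    then show ?thesis using assms by (simp add: power3_eq_cube power2_eq_square add_increasing)
  next
    case False
    then have "b * c\<^sup>2 \<le> b * b\<^sup>2" using assms by (intro mult_left_mono power_mono) auto
    then show ?thesis using assms by (simp add: power3_eq_cube power2_eq_square add_increasing2)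
  qed
  have 4: "0 \<le> b ^ 3" "0 \<le> c ^ 3" using assms by simp_all
  have "a * b\<^sup>2 = b * (a * b)" "2 * a * b * c = b * (2 * a * c)"
    "b * (10 * a\<^sup>2 + b\<^sup>2 / 40) = 10 * a\<^sup>2 * b + b ^ 3 / 40"
    "b * (10 * a\<^sup>2 + c\<^sup>2 / 10) = 10 * a\<^sup>2 * b + b * c\<^sup>2 / 10"
    by (simp_all add: power3_eq_cube power2_eq_square algebra_simps)
  with 1 2 3 4 show ?thesis by linarith
qed

text \<open>Inserting \<open>M * 2 ^ n\<close> into the recursion multiplies it by
  \<open>(2 + 4) / 16 = 3 / 8\<close>, so iteration removes it; \<open>13 * C\<close> reproduces
  itself because \<open>11 + 26 / 16 \<le> 13\<close>.\<close>

lemma bounded_by_iteration: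
  fixes y :: "nat \<Rightarrow> real"
  assumes step: "\<And>n. n \<ge> 1 \<Longrightarrow> y n \<le> 11 * C + (y (n + 1) + y (n + 2)) / 16"
    and growth: "\<And>n. n \<ge> 1 \<Longrightarrow> y n \<le> M * 2 ^ n"
    and "C \<ge> 0" "n \<ge> 1"
  shows "y n \<le> 13 * C"
proof -
  have bound: "y n \<le> 13 * C + M * 2 ^ n * (3 / 8) ^ m" if "n \<ge> 1" for m n
    using that
  proof (induction m arbitrary: n)
    case 0
    then show ?case using growth[of n] \<open>C \<ge> 0\<close> by simp
  next
    case (Suc m)
    have "y n \<le> 11 * C + (y (n + 1) + y (n + 2)) / 16" using step Suc.prems .
    also have "\<dots> \<le> 11 * C + ((13 * C + M * 2 ^ (n + 1) * (3 / 8) ^ m)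
                           + (13 * C + M * 2 ^ (n + 2) * (3 / 8) ^ m)) / 16"
      using Suc.IH[of "n + 1"] Suc.IH[of "n + 2"] by (intro add_left_mono divide_right_mono add_mono) auto
    also have "\<dots> \<le> 13 * C + M * 2 ^ n * (3 / 8) ^ Suc m"
      using \<open>C \<ge> 0\<close> by (simp add: algebra_simps)
    finally show ?case .
  qed
  have "(\<lambda>m. 13 * C + M * 2 ^ n * (3 / 8) ^ m) \<longlonglongrightarrow> 13 * C + M * 2 ^ n * 0"
    by (intro tendsto_intros LIMSEQ_power_zero) auto
  then have "y n \<le> 13 * C + M * 2 ^ n * 0"
    by (rule LIMSEQ_le_const) (use bound \<open>n \<ge> 1\<close> in auto)
  then show ?thesis by simp
qed

section \<open>Elementary properties of a fixed solution\<close>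

context
  fixes X :: "nat \<Rightarrow> real \<Rightarrow> real"
  assumes sol: "positive_finite_energy_solution X"
begin

lemma X_0: "t \<ge> 0 \<Longrightarrow> X 0 t = 0"
  using sol by (auto simp: positive_finite_energy_solution_def componentwise_solution_def)

lemma X_nonneg: "t \<ge> 0 \<Longrightarrow> X n t \<ge> 0"
  using sol X_0[of t]
  by (cases n) (auto simp: positive_finite_energy_solution_def Defs.positive_def)

lemma X_deriv:
  assumes "n \<ge> 1" "t \<ge> 0" "S \<subseteq> {0..}"
  shows "(X n has_real_derivative
           kcoeff (n - 1) * (X (n - 1) t)\<^sup>2 - kcoeff n * X n t * X (n + 1) t) (at t within S)"
proof (rule DERIV_subset[OF _ assms(3)])
  show "(X n has_real_derivative
           kcoeff (n - 1) * (X (n - 1) t)\<^sup>2 - kcoeff n * X n t * X (n + 1) t) (at t within {0..})"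
    using sol assms by (auto simp: positive_finite_energy_solution_def componentwise_solution_def)
qed

lemma X_continuous [continuous_intros]: "continuous_on {0..T} (X n)"
proof (cases "n = 0")
  case True
  have "continuous_on {0..T} (X 0) \<longleftrightarrow> continuous_on {0..T} (\<lambda>_. 0 :: real)"
    by (rule continuous_on_cong) (auto simp: X_0)
  then show ?thesis using True by simp
next
  case False
  then show ?thesis
    by (intro DERIV_continuous_on[where D = "\<lambda>t. kcoeff (n - 1) * (X (n - 1) t)\<^sup>2 - kcoeff n * X n t * X (n + 1) t"]
        X_deriv) auto
qed

section \<open>Balance and monotonicity of the energy\<close>

definition partial_energy :: "nat \<Rightarrow> real \<Rightarrow> real" where
  "partial_energy N t = (\<Sum>n<N. (X (Suc n) t)\<^sup>2)"

text \<open>The sum telescopes; for \<open>N = 0\<close> the right-hand side vanishes by the convention \<open>X\<^sub>0 = 0\<close>.\<close>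

lemma partial_energy_deriv:
  assumes "t \<ge> 0" "S \<subseteq> {0..}"
  shows "(partial_energy N has_real_derivative - 2 * kcoeff N * (X N t)\<^sup>2 * X (N + 1) t) (at t within S)"
proof (induction N)
  case 0
  then show ?case using assms X_0 by (simp add: partial_energy_def[abs_def])
next
  case (Suc N)
  have "((\<lambda>t. partial_energy N t + (X (Suc N) t)\<^sup>2) has_real_derivative
     - 2 * kcoeff (Suc N) * (X (Suc N) t)\<^sup>2 * X (Suc N + 1) t) (at t within S)"
    using X_deriv[of "Suc N" t S] assms
    by (auto intro!: derivative_eq_intros Suc simp: algebra_simps power2_eq_square)
  then show ?case by (simp add: partial_energy_def[abs_def])
qed

lemma partial_energy_antimono:
  assumes "0 \<le> s" "s \<le> t"
  shows "partial_energy N t \<le> partial_energy N s"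
proof (rule DERIV_nonpos_imp_decreasing_open[OF assms(2)])
  fix x assume "s < x" "x < t"
  \<comment> \<open>The open set \<open>{0<..}\<close> makes the derivative two-sided, as the
    monotonicity criterion asks.\<close>
  then have "(partial_energy N has_real_derivative - 2 * kcoeff N * (X N x)\<^sup>2 * X (N + 1) x) (at x within {0<..})"
    using assms by (intro partial_energy_deriv) auto
  then have "(partial_energy N has_real_derivative - 2 * kcoeff N * (X N x)\<^sup>2 * X (N + 1) x) (at x)"
    using at_within_open[of x "{0<..}"] assms \<open>s < x\<close> by simp
  moreover have "- 2 * kcoeff N * (X N x)\<^sup>2 * X (N + 1) x \<le> 0"
    using X_nonneg[of x "N + 1"] assms \<open>s < x\<close> by (simp add: kcoeff_def)
  ultimately show "\<exists>y. (partial_energy N has_real_derivative y) (at x) \<and> y \<le> 0" by blast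
next
  show "continuous_on {s..t} (partial_energy N)"
    using assms by (intro DERIV_continuous_on[OF partial_energy_deriv]) auto
qed

lemma energy_sums:
  assumes "t \<ge> 0"
  shows "(\<lambda>n. (X (Suc n) t)\<^sup>2) sums (norm_H (\<lambda>n. X n t))\<^sup>2"
proof -
  have "summable (\<lambda>n. (X (Suc n) t)\<^sup>2)"
    using sol assms by (auto simp: positive_finite_energy_solution_def finite_energy_def in_H_def)
  then show ?thesis by (simp add: norm_H_def suminf_nonneg summable_sums)
qed

lemma partial_energy_le:
  assumes "norm_H (\<lambda>n. X n 0) \<le> L" "t \<ge> 0"
  shows "partial_energy N t \<le> L\<^sup>2"
proof -
  have "partial_energy N t \<le> partial_energy N 0" using assms(2) by (intro partial_energy_antimono) auto
  also have "\<dots> \<le> (norm_H (\<lambda>n. X n 0))\<^sup>2"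
    unfolding partial_energy_def using energy_sums[of 0]
    by (simp add: sums_iff) (metis sum_le_suminf finite_lessThan zero_le_power2)
  also have "\<dots> \<le> L\<^sup>2"
    using assms(1) energy_sums[of 0]
    by (intro power_mono) (auto simp: norm_H_def sums_iff intro!: suminf_nonneg)
  finally show ?thesis .
qed

lemma X_le:
  assumes "norm_H (\<lambda>n. X n 0) \<le> L" "L \<ge> 0" "t \<ge> 0"
  shows "X n t \<le> L"
proof (cases n)
  case 0
  then show ?thesis using assms X_0 by simp
next
  case (Suc m)
  have "(X n t)\<^sup>2 \<le> partial_energy n t"
    unfolding partial_energy_def Suc by (simp add: sum_nonneg)
  also have "\<dots> \<le> L\<^sup>2" using assms by (intro partial_energy_le)
  finally show ?thesis using assms(2) by (rule power2_le_imp_le)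
qed

text \<open>Up to the factor \<open>2 * kcoeff n\<close>, the integrand is the rate at which the
  first \<open>n\<close> components lose energy; the total loss cannot exceed their initial energy,
  whatever \<open>T\<close> is.\<close>

lemma flux_integral_le:
  assumes "norm_H (\<lambda>n. X n 0) \<le> L" "T \<ge> 0"
  shows "2 * kcoeff n * integral {0..T} (\<lambda>t. (X n t)\<^sup>2 * X (n + 1) t) \<le> L\<^sup>2"
proof -
  have "((\<lambda>t. - 2 * kcoeff n * (X n t)\<^sup>2 * X (n + 1) t) has_integral
      partial_energy n T - partial_energy n 0) {0..T}"
    using assms(2) partial_energy_deriv
    by (intro fundamental_theorem_of_calculus)
      (auto simp flip: has_real_derivative_iff_has_vector_derivative)
  then have "integral {0..T} (\<lambda>t. (- 2 * kcoeff n) * ((X n t)\<^sup>2 * X (n + 1) t))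
      = partial_energy n T - partial_energy n 0"
    unfolding mult.assoc by (rule integral_unique)
  moreover have "partial_energy n 0 \<le> L\<^sup>2" using assms by (intro partial_energy_le) auto
  moreover have "0 \<le> partial_energy n T" by (simp add: partial_energy_def sum_nonneg)
  ultimately show ?thesis by (simp only: integral_mult_right)
qed

section \<open>Time integrals of cubes and squares\<close>

lemma cube_integral_step:
  assumes "norm_H (\<lambda>n. X n 0) \<le> L" "L \<ge> 0" "T \<ge> 0" "n \<ge> 1"
  defines "y \<equiv> \<lambda>n. kcoeff n * integral {0..T} (\<lambda>t. X n t ^ 3)"
  shows "y n \<le> 11 * L\<^sup>2 + (y (n + 1) + y (n + 2)) / 16"
proof -
  \<comment> \<open>Product rule for \<open>X n t * X (n + 1) t\<close>, whose boundary values
    contribute at most \<open>L\<^sup>2\<close>.\<close>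
  define D where "D t =
      (kcoeff (n - 1) * (X (n - 1) t)\<^sup>2 - kcoeff n * X n t * X (n + 1) t) * X (n + 1) t
    + (kcoeff n * (X n t)\<^sup>2 - kcoeff (n + 1) * X (n + 1) t * X (n + 2) t) * X n t" for t
  have "((\<lambda>t. X n t * X (n + 1) t) has_real_derivative D t) (at t within {0..T})"
    if "t \<in> {0..T}" for t
    unfolding D_def using that \<open>n \<ge> 1\<close> X_deriv[of n t "{0..T}"] X_deriv[of "n + 1" t "{0..T}"]
    by (intro DERIV_mult) auto
  then have "(D has_integral X n T * X (n + 1) T - X n 0 * X (n + 1) 0) {0..T}"
    using \<open>T \<ge> 0\<close>
    by (intro fundamental_theorem_of_calculus)
      (auto simp flip: has_real_derivative_iff_has_vector_derivative)
  moreover have "X n T * X (n + 1) T \<le> L * L"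
    using assms X_le X_nonneg by (intro mult_mono) auto
  moreover have "0 \<le> X n 0 * X (n + 1) 0" by (simp add: X_nonneg)
  ultimately have D: "D integrable_on {0..T}" "integral {0..T} D \<le> L\<^sup>2"
    by (auto simp: integral_unique power2_eq_square)
  have integrable: "(\<lambda>t. (X m t)\<^sup>2 * X (m + 1) t) integrable_on {0..T}"
    "(\<lambda>t. X m t ^ 3) integrable_on {0..T}" for m
    by (intro integrable_continuous_real continuous_intros)+
  define R where "R t = D t + kcoeff n * 20 * ((X n t)\<^sup>2 * X (n + 1) t)
    + (kcoeff (n + 1) / 16) * X (n + 1) t ^ 3 + (kcoeff (n + 2) / 16) * X (n + 2) t ^ 3" for t
  have R: "(R has_integral integral {0..T} D
      + kcoeff n * 20 * integral {0..T} (\<lambda>t. (X n t)\<^sup>2 * X (n + 1) t)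
      + (kcoeff (n + 1) / 16) * integral {0..T} (\<lambda>t. X (n + 1) t ^ 3)
      + (kcoeff (n + 2) / 16) * integral {0..T} (\<lambda>t. X (n + 2) t ^ 3)) {0..T}"
    unfolding R_def[abs_def] using D
    by (intro has_integral_add has_integral_mult_right integrable_integral integrable)
  have "y n = integral {0..T} (\<lambda>t. kcoeff n * X n t ^ 3)" by (simp add: y_def)
  also have "\<dots> \<le> integral {0..T} R"
  proof (rule integral_le)
    show "(\<lambda>t. kcoeff n * X n t ^ 3) integrable_on {0..T}"
      by (intro integrable_on_mult_right integrable)
    show "R integrable_on {0..T}" using R by blast
    fix t assume t: "t \<in> {0..T}"
    have "X n t * (X (n + 1) t)\<^sup>2 + 2 * X n t * X (n + 1) t * X (n + 2) t
        \<le> 20 * (X n t)\<^sup>2 * X (n + 1) t + (1 / 8) * X (n + 1) t ^ 3 + (1 / 4) * X (n + 2) t ^ 3"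
      using t by (intro cube_le_flux_and_cubes X_nonneg) auto
    then have "kcoeff n * (X n t * (X (n + 1) t)\<^sup>2 + 2 * X n t * X (n + 1) t * X (n + 2) t)
        \<le> kcoeff n * (20 * (X n t)\<^sup>2 * X (n + 1) t + (1 / 8) * X (n + 1) t ^ 3 + (1 / 4) * X (n + 2) t ^ 3)"
      by (rule mult_left_mono) (simp add: kcoeff_def)
    \<comment> \<open>The inflow from component \<open>n - 1\<close> enters \<open>D\<close> with
      favourable sign and is dropped.\<close>
    moreover have "0 \<le> kcoeff (n - 1) * (X (n - 1) t)\<^sup>2 * X (n + 1) t"
      using t by (simp add: X_nonneg kcoeff_def)
    ultimately show "kcoeff n * X n t ^ 3 \<le> R t"
      by (simp add: R_def D_def kcoeff_def algebra_simps power2_eq_square power3_eq_cube)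
  qed
  \<comment> \<open>The factor 11 is 1 from the boundary values plus 10 from \<open>20\<close> times
    half the flux bound.\<close>
  also have "\<dots> \<le> 11 * L\<^sup>2 + (y (n + 1) + y (n + 2)) / 16"
    using R D flux_integral_le[OF assms(1) \<open>T \<ge> 0\<close>, of n]
    by (simp add: integral_unique y_def algebra_simps add_divide_distrib)
  finally show ?thesis .
qed

lemma cube_integral_le:
  assumes "norm_H (\<lambda>n. X n 0) \<le> L" "L \<ge> 0" "T \<ge> 0" "n \<ge> 1"
  shows "integral {0..T} (\<lambda>t. X n t ^ 3) \<le> 13 * L\<^sup>2 / 2 ^ n"
proof -
  have "kcoeff n * integral {0..T} (\<lambda>t. X n t ^ 3) \<le> 13 * L\<^sup>2"
  \<comment> \<open>\<open>M\<close> may depend on \<open>T\<close>, since it disappears from the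
    conclusion of the iteration.\<close>
  proof (rule bounded_by_iteration[where M = "T * L ^ 3"
        and y = "\<lambda>n. kcoeff n * integral {0..T} (\<lambda>t. X n t ^ 3)"])
    fix n :: nat
    have "integral {0..T} (\<lambda>t. X n t ^ 3) \<le> integral {0..T} (\<lambda>t. L ^ 3)"
      using assms X_le X_nonneg
      by (intro integral_le integrable_continuous_real continuous_intros power_mono) auto
    then show "kcoeff n * integral {0..T} (\<lambda>t. X n t ^ 3) \<le> T * L ^ 3 * 2 ^ n"
      using \<open>T \<ge> 0\<close> by (simp add: kcoeff_def)
  qed (use assms cube_integral_step in auto)
  then show ?thesis by (simp add: kcoeff_def field_simps)
qed

lemma square_integral_le:
  assumes "norm_H (\<lambda>n. X n 0) \<le> L" "L \<ge> 0" "T \<ge> 0" "\<delta> > 0" "n \<ge> 1"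
  shows "integral {0..T} (\<lambda>t. (X n t)\<^sup>2) \<le> T * \<delta>\<^sup>2 * (9 / 16) ^ n + 13 * L\<^sup>2 / \<delta> * (2 / 3) ^ n"
proof -
  \<comment> \<open>A ratio strictly between \<open>1 / 2\<close> and \<open>1\<close> makes both
    \<open>r\<^sup>2\<close> and \<open>1 / (2 ^ n * r)\<close> summable in \<open>n\<close>;
    \<open>3 / 4\<close> yields the ratios \<open>9 / 16\<close> and \<open>2 / 3\<close>.\<close>
  define r where "r = \<delta> * (3 / 4) ^ n"
  have "r > 0" using assms by (simp add: r_def)
  have "integral {0..T} (\<lambda>t. (X n t)\<^sup>2) \<le> integral {0..T} (\<lambda>t. r\<^sup>2 + X n t ^ 3 / r)"
    using \<open>r > 0\<close> X_nonneg
    by (intro integral_le integrable_continuous_real continuous_intros square_le_cube_interpolation) auto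
  also have "\<dots> = integral {0..T} (\<lambda>t. r\<^sup>2) + integral {0..T} (\<lambda>t. X n t ^ 3 / r)"
    using \<open>r > 0\<close> by (intro integral_add integrable_continuous_real continuous_intros) auto
  also have "\<dots> = T * r\<^sup>2 + integral {0..T} (\<lambda>t. X n t ^ 3) / r" using \<open>T \<ge> 0\<close> by simp
  also have "\<dots> \<le> T * r\<^sup>2 + 13 * L\<^sup>2 / 2 ^ n / r"
    using \<open>r > 0\<close> assms by (intro add_left_mono divide_right_mono cube_integral_le) auto
  also have "T * r\<^sup>2 = T * \<delta>\<^sup>2 * (9 / 16) ^ n"
    by (simp add: r_def power_mult_distrib power_divide flip: power_mult)
      (simp add: mult.commute[of n] power_mult)
  also have "13 * L\<^sup>2 / 2 ^ n / r = 13 * L\<^sup>2 / \<delta> * (2 / 3) ^ n"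
  proof -
    have "(4::real) ^ n = 2 ^ n * 2 ^ n" by (simp flip: power_mult_distrib)
    then show ?thesis by (simp add: r_def power_divide)
  qed
  finally show ?thesis .
qed

text \<open>The square bounds are summed over all components and divided by \<open>T\<close>. The
  free \<open>\<delta>\<close> separates the two limits: it is chosen small first, then
  \<open>T\<close> large.\<close>

lemma energy_le:
  assumes "norm_H (\<lambda>n. X n 0) \<le> L" "L \<ge> 0" "T > 0" "\<delta> > 0"
  shows "(norm_H (\<lambda>n. X n T))\<^sup>2 \<le> 3 * \<delta>\<^sup>2 + 39 * L\<^sup>2 / (\<delta> * T)"
proof -
  have "partial_energy N T \<le> 3 * \<delta>\<^sup>2 + 39 * L\<^sup>2 / (\<delta> * T)" for N
  proof -
    have geometric: "(\<Sum>n<N. q ^ n) \<le> 3" if "0 \<le> q" "q \<le> 2 / 3" for q :: real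
    proof -
      have "(\<Sum>n<N. q ^ n) = (1 - q ^ N) / (1 - q)" using that by (simp add: sum_gp_strict)
      also have "\<dots> \<le> 1 / (1 / 3)" using that by (intro frac_le) auto
      finally show ?thesis by simp
    qed
    have "T * partial_energy N T = integral {0..T} (\<lambda>t. partial_energy N T)"
      using \<open>T > 0\<close> by simp
    also have "\<dots> \<le> integral {0..T} (partial_energy N)"
      using partial_energy_antimono unfolding partial_energy_def
      by (intro integral_le integrable_continuous_real continuous_intros) auto
    also have "\<dots> = (\<Sum>n<N. integral {0..T} (\<lambda>t. (X (Suc n) t)\<^sup>2))"
      unfolding partial_energy_def
      by (intro integral_sum integrable_continuous_real continuous_intros) auto
    also have "\<dots> \<le> (\<Sum>n<N. T * \<delta>\<^sup>2 * (9 / 16) ^ n + 13 * L\<^sup>2 / \<delta> * (2 / 3) ^ n)"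
    proof (rule sum_mono)
      fix n
      have "integral {0..T} (\<lambda>t. (X (Suc n) t)\<^sup>2)
          \<le> T * \<delta>\<^sup>2 * (9 / 16) ^ Suc n + 13 * L\<^sup>2 / \<delta> * (2 / 3) ^ Suc n"
        using assms by (intro square_integral_le) auto
      \<comment> \<open>Lowering the exponent lets the geometric sums start at exponent 0.\<close>
      also have "\<dots> \<le> T * \<delta>\<^sup>2 * (9 / 16) ^ n + 13 * L\<^sup>2 / \<delta> * (2 / 3) ^ n"
        using assms by (intro add_mono mult_left_mono power_decreasing) auto
      finally show "integral {0..T} (\<lambda>t. (X (Suc n) t)\<^sup>2)
          \<le> T * \<delta>\<^sup>2 * (9 / 16) ^ n + 13 * L\<^sup>2 / \<delta> * (2 / 3) ^ n" .
    qed
    also have "\<dots> = T * \<delta>\<^sup>2 * (\<Sum>n<N. (9 / 16) ^ n) + 13 * L\<^sup>2 / \<delta> * (\<Sum>n<N. (2 / 3) ^ n)"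
      by (simp add: sum.distrib sum_distrib_left)
    also have "\<dots> \<le> T * \<delta>\<^sup>2 * 3 + 13 * L\<^sup>2 / \<delta> * 3"
      using assms geometric by (intro add_mono mult_left_mono) auto
    finally show ?thesis using assms by (simp add: field_simps)
  qed
  then show ?thesis
    using energy_sums[of T] \<open>T > 0\<close> unfolding sums_def partial_energy_def
    by (intro LIMSEQ_le_const2) auto
qed

end

section \<open>Uniform decay and its consequences\<close>

text \<open>Covering all \<open>t \<ge> T\<close>, not just \<open>t = T\<close>, it serves both the
  limit and the uniform time.\<close>

lemma uniform_energy_decay:
  fixes L \<alpha> :: real
  assumes "L > 0" "\<alpha> > 0"
  obtains T where "T > 0"
    "\<And>X t. positive_finite_energy_solution X \<Longrightarrow> norm_H (\<lambda>n. X n 0) \<le> L \<Longrightarrow> t \<ge> T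
       \<Longrightarrow> (norm_H (\<lambda>n. X n t))\<^sup>2 \<le> \<alpha>"
proof
  \<comment> \<open>With these choices each of the two terms in \<open>energy_le\<close> equals
    \<open>\<alpha> / 2\<close> at time \<open>T\<close>.\<close>
  define \<delta> where "\<delta> = sqrt (\<alpha> / 6)"
  define T where "T = 78 * L\<^sup>2 / (\<delta> * \<alpha>)"
  have "\<delta> > 0" and \<delta>2: "\<delta>\<^sup>2 = \<alpha> / 6" using assms by (auto simp: \<delta>_def)
  then show "T > 0" using assms by (simp add: T_def)
  fix X t
  assume X: "positive_finite_energy_solution X" "norm_H (\<lambda>n. X n 0) \<le> L" "t \<ge> T"
  then have "t > 0" using \<open>T > 0\<close> by linarith
  have "78 * L\<^sup>2 \<le> \<delta> * \<alpha> * t"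
    using X(3) assms \<open>\<delta> > 0\<close> by (simp add: T_def divide_simps mult.commute)
  then have "39 * L\<^sup>2 / (\<delta> * t) \<le> \<alpha> / 2"
    using \<open>\<delta> > 0\<close> \<open>t > 0\<close> by (simp add: field_simps)
  then show "(norm_H (\<lambda>n. X n t))\<^sup>2 \<le> \<alpha>"
    using energy_le[OF X(1,2) _ \<open>t > 0\<close> \<open>\<delta> > 0\<close>] assms by (simp add: \<delta>2)
qed

theorem theorem6:
  shows "(\<forall>X. positive_finite_energy_solution X \<longrightarrow>
            ((\<lambda>t. (norm_H (\<lambda>n. X n t))\<^sup>2) \<longlongrightarrow> 0) at_top)
       \<and> (\<forall>(L::real)>0. \<forall>(\<alpha>::real)>0. \<exists>(T::real)>0. \<forall>X.
            positive_finite_energy_solution X \<and> norm_H (\<lambda>n. X n 0) \<le> L \<longrightarrow>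
            (norm_H (\<lambda>n. X n T))\<^sup>2 \<le> \<alpha>)"
proof (intro conjI allI impI)
  fix X
  assume X: "positive_finite_energy_solution X"
  show "((\<lambda>t. (norm_H (\<lambda>n. X n t))\<^sup>2) \<longlongrightarrow> 0) at_top"
  proof (rule tendstoI)
    fix e :: real
    assume "e > 0"
    \<comment> \<open>The maximum with 1 keeps the bound positive even for zero initial data;
      \<open>e / 2\<close> makes the final inequality strict.\<close>
    obtain T where T: "\<And>Y t. positive_finite_energy_solution Y \<Longrightarrow>
        norm_H (\<lambda>n. Y n 0) \<le> max 1 (norm_H (\<lambda>n. X n 0)) \<Longrightarrow> t \<ge> T \<Longrightarrow>
        (norm_H (\<lambda>n. Y n t))\<^sup>2 \<le> e / 2"
      by (rule uniform_energy_decay[of "max 1 (norm_H (\<lambda>n. X n 0))" "e / 2"])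
        (use \<open>e > 0\<close> in auto)
    have "dist ((norm_H (\<lambda>n. X n t))\<^sup>2) 0 < e" if "t \<ge> T" for t
      using T[OF X _ that] \<open>e > 0\<close> by (simp add: dist_real_def)
    then show "\<forall>\<^sub>F t in at_top. dist ((norm_H (\<lambda>n. X n t))\<^sup>2) 0 < e"
      using eventually_at_top_linorder by blast
  qed
next
  fix L \<alpha> :: real
  assume "L > 0" "\<alpha> > 0"
  then show "\<exists>T>0. \<forall>X. positive_finite_energy_solution X \<and> norm_H (\<lambda>n. X n 0) \<le> L \<longrightarrow>
      (norm_H (\<lambda>n. X n T))\<^sup>2 \<le> \<alpha>"
    by (rule uniform_energy_decay) auto
qed

end
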